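(* Let $G$ be a very well-covered graph. If $G$ is vertex decomposable, then $\mathrm{Shed}(G)$ is a dominating set of $G$.
   Context: All graphs are finite and simple. A graph is well-covered if all its maximal independent sets have the same cardinality; it is very well-covered if it is well-covered and every maximal independent set has cardinality $|V|/2$. For a graph $G=(V,E)$ and $x\in V$, $G\setminus x$ is the graph obtained by deleting $x$ and its incident edges; $N(x)$ is the set of neighbours of $x$, $N[x]=N(x)\cup\{x\}$, and $G\setminus N[x]$ is obtained by deleting all vertices of $N[x]$ and their incident edges. A graph $G$ is vertex decomposable if $G$ is well-covered and either (i) $G$ has no edges (possibly no vertices), or (ii) there is a vertex $x$ such that both $G\setminus x$ and $G\setminus N[x]$ are vertex decomposable. For a vertex decomposable graph $G$, $\mathrm{Shed}(G)$ is the set of vertices $x$ such that $G\setminus x$ and $G\setminus N[x]$ are both vertex decomposable. A set $D\subseteq V$ is dominating if every vertex of $V\setminus D$ is adjacent to a vertex of $D$.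
   Formalization: The formal theorem additionally assumes that G has no isolated vertices, as in the classical notion of very well-covered; without this the claim fails, since any vertex decomposable graph becomes very well-covered in the quoted sense after adding isolated vertices. *)

theory Defs
  imports "Graph_Theory.Graph_Theory"
begin

text \<open>
  Finite simple graphs are rendered by the locale \<open>graph\<close>: finite, loop-free, symmetric digraphs
  without parallel arcs. An undirected edge is a pair of opposite arcs, and \<open>u \<rightarrow>\<^bsub>G\<^esub> v\<close> is adjacency.
\<close>

definition neighbours :: "('a, 'b) pre_digraph \<Rightarrow> 'a \<Rightarrow> 'a set" where
  "neighbours G x = {y \<in> verts G. x \<rightarrow>\<^bsub>G\<^esub> y}"

definition closed_neighbours :: "('a, 'b) pre_digraph \<Rightarrow> 'a \<Rightarrow> 'a set" where
  "closed_neighbours G x = neighbours G x \<union> {x}"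

definition del_verts :: "('a, 'b) pre_digraph \<Rightarrow> 'a set \<Rightarrow> ('a, 'b) pre_digraph" where
  "del_verts G S = G \<restriction> (verts G - S)"

definition independent_set :: "('a, 'b) pre_digraph \<Rightarrow> 'a set \<Rightarrow> bool" where
  "independent_set G S \<longleftrightarrow> S \<subseteq> verts G \<and> (\<forall>u \<in> S. \<forall>v \<in> S. \<not> u \<rightarrow>\<^bsub>G\<^esub> v)"

definition maximal_independent_set :: "('a, 'b) pre_digraph \<Rightarrow> 'a set \<Rightarrow> bool" where
  "maximal_independent_set G S \<longleftrightarrow>
     independent_set G S \<and> (\<forall>T. independent_set G T \<longrightarrow> S \<subseteq> T \<longrightarrow> T = S)"

definition well_covered :: "('a, 'b) pre_digraph \<Rightarrow> bool" where
  "well_covered G \<longleftrightarrow>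
     (\<forall>S T. maximal_independent_set G S \<longrightarrow> maximal_independent_set G T \<longrightarrow> card S = card T)"

definition very_well_covered :: "('a, 'b) pre_digraph \<Rightarrow> bool" where
  "very_well_covered G \<longleftrightarrow>
     well_covered G \<and> (\<forall>S. maximal_independent_set G S \<longrightarrow> 2 * card S = card (verts G))"

inductive vertex_decomposable :: "('a, 'b) pre_digraph \<Rightarrow> bool" where
  no_edges: "well_covered G \<Longrightarrow> arcs G = {} \<Longrightarrow> vertex_decomposable G"
| shedding: "well_covered G \<Longrightarrow> x \<in> verts G \<Longrightarrow>
    vertex_decomposable (pre_digraph.del_vert G x) \<Longrightarrow>
    vertex_decomposable (del_verts G (closed_neighbours G x)) \<Longrightarrow> vertex_decomposable G"

definition Shed :: "('a, 'b) pre_digraph \<Rightarrow> 'a set" where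
  "Shed G = {x \<in> verts G. vertex_decomposable (pre_digraph.del_vert G x) \<and>
     vertex_decomposable (del_verts G (closed_neighbours G x))}"

definition dominating_set :: "('a, 'b) pre_digraph \<Rightarrow> 'a set \<Rightarrow> bool" where
  "dominating_set G D \<longleftrightarrow> D \<subseteq> verts G \<and> (\<forall>v \<in> verts G - D. \<exists>u \<in> D. v \<rightarrow>\<^bsub>G\<^esub> u)"

text \<open>
  The classical notion of a very well-covered graph (Favaron) excludes isolated vertices.
  \<open>very_well_covered\<close> alone does not: an arbitrary well-covered graph \<open>H\<close> without isolated
  vertices satisfies it after adding \<open>card (verts H) - 2 * \<alpha>\<close> isolated vertices, where \<open>\<alpha>\<close> is
  the size of its maximal independent sets.
\<close>

definition no_isolated_vertices :: "('a, 'b) pre_digraph \<Rightarrow> bool" where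
  "no_isolated_vertices G \<longleftrightarrow> (\<forall>v \<in> verts G. neighbours G v \<noteq> {})"

end

theory Submission
  imports Defs
begin

text \<open>
  If \<open>x\<close> is a leaf with neighbour \<open>y\<close>, then \<open>G \<setminus> y\<close> is \<open>G \<setminus> N[x]\<close> plus an isolated vertex, and links
  of vertex decomposable graphs are vertex decomposable, so \<open>y\<close> is a shedding vertex. Hence it
  suffices that every vertex \<open>v\<close> has a neighbour that is the neighbour of a leaf.

  Let \<open>T v\<close> consist of the \<open>t \<notin> N v\<close> with \<open>N t \<subseteq> N v\<close>. Comparing sizes in \<open>G\<close> and in the link of
  \<open>T v\<close> gives \<open>card (T v) = card (N v)\<close>. Take \<open>t \<in> T v\<close> with \<open>N t\<close> smallest. Then all of
  \<open>A = T t\<close> have the same neighbourhood \<open>B = N t\<close>, and \<open>card A = card B\<close>. If this number is at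
  least 2, some link has the complete bipartite graph on \<open>A\<close> and \<open>B\<close> as a component, which is
  impossible in a vertex decomposable graph. So \<open>t\<close> is a leaf, and its neighbour lies in \<open>N v\<close>.
\<close>

section \<open>Stable sets and vertex decomposability of vertex sets\<close>

locale adjacency =
  fixes E :: "'a \<Rightarrow> 'a \<Rightarrow> bool"
  assumes sym: "E x y \<Longrightarrow> E y x"
    and irrefl: "\<not> E x x"
begin

text \<open>The relation \<open>E\<close> stays fixed and an induced subgraph is given by its vertex
  set \<open>U\<close> alone, so identities between deletions and links become equalities of
  sets.\<close>

definition nbrs :: "'a set \<Rightarrow> 'a set \<Rightarrow> 'a set" where
  "nbrs U S = {y \<in> U. \<exists>x \<in> S. E x y}"

definition stable :: "'a set \<Rightarrow> bool" where
  "stable S \<longleftrightarrow> (\<forall>u \<in> S. \<forall>v \<in> S. \<not> E u v)"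

definition mstable :: "'a set \<Rightarrow> 'a set \<Rightarrow> bool" where
  "mstable U S \<longleftrightarrow> S \<subseteq> U \<and> stable S \<and> (\<forall>y \<in> U - S. \<exists>x \<in> S. E x y)"

definition wc :: "'a set \<Rightarrow> bool" where
  "wc U \<longleftrightarrow> (\<forall>S T. mstable U S \<longrightarrow> mstable U T \<longrightarrow> card S = card T)"

definition no_isolated :: "'a set \<Rightarrow> bool" where
  "no_isolated U \<longleftrightarrow> (\<forall>v \<in> U. nbrs U {v} \<noteq> {})"

text \<open>The link of \<open>S\<close> in the independence complex of \<open>U\<close>, for stable \<open>S \<subseteq> U\<close>.\<close>

definition link :: "'a set \<Rightarrow> 'a set \<Rightarrow> 'a set" where
  "link U S = U - (nbrs U S \<union> S)"

inductive vdec :: "'a set \<Rightarrow> bool" where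
  edgeless: "wc U \<Longrightarrow> stable U \<Longrightarrow> vdec U"
| shed: "wc U \<Longrightarrow> x \<in> U \<Longrightarrow> vdec (U - {x}) \<Longrightarrow> vdec (link U {x}) \<Longrightarrow> vdec U"

lemma wcD: "wc U \<Longrightarrow> mstable U S \<Longrightarrow> mstable U T \<Longrightarrow> card S = card T"
  unfolding wc_def by blast

lemma vdec_wc: "vdec U \<Longrightarrow> wc U"
  by (auto elim: vdec.cases)

lemma stable_subset: "stable T \<Longrightarrow> S \<subseteq> T \<Longrightarrow> stable S"
  unfolding stable_def by blast

lemma ex_mstable:
  assumes "finite U" "S \<subseteq> U" "stable S"
  shows "\<exists>M. S \<subseteq> M \<and> mstable U M"
  using assms(2,3)
proof (induction "card (U - S)" arbitrary: S rule: less_induct)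
  case less
  show ?case
  proof (cases "mstable U S")
    case False
    then obtain y where y: "y \<in> U - S" "\<forall>x \<in> S. \<not> E x y"
      using less.prems unfolding mstable_def by blast
    have "stable (insert y S)"
      using y less.prems(2) sym irrefl unfolding stable_def by blast
    moreover have "card (U - insert y S) < card (U - S)"
      using y assms(1) by (intro psubset_card_mono) auto
    ultimately obtain M where "insert y S \<subseteq> M" "mstable U M"
      using less.hyps[of "insert y S"] less.prems y by auto
    then show ?thesis by blast
  qed blast
qed

text \<open>The basis of all exchange arguments below: changing a maximal stable set into another
  stable set cannot enlarge it.\<close>

lemma card_stable_le:
  assumes "finite U" "wc U" "S \<subseteq> U" "stable S" "mstable U M"
  shows "card S \<le> card M"
proof -
  obtain M' where M': "S \<subseteq> M'" "mstable U M'"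
    using ex_mstable[OF assms(1,3,4)] by blast
  then have "M' \<subseteq> U" unfolding mstable_def by blast
  then have "card S \<le> card M'" using M'(1) assms(1) by (meson card_mono finite_subset)
  also have "card M' = card M" using wcD[OF assms(2) M'(2) assms(5)] .
  finally show ?thesis .
qed

lemma mstable_link:
  assumes "S \<subseteq> U" "stable S" "mstable (link U S) M"
  shows "mstable U (M \<union> S)"
proof -
  have M: "M \<subseteq> U" "stable M" "\<And>x y. x \<in> M \<Longrightarrow> y \<in> S \<Longrightarrow> \<not> E x y \<and> \<not> E y x"
    using assms(3) sym unfolding mstable_def link_def nbrs_def by blast+
  have "\<exists>x \<in> M \<union> S. E x y" if "y \<in> U - (M \<union> S)" for y
    using assms(3) that unfolding mstable_def link_def nbrs_def by blast
  moreover have "stable (M \<union> S)" using M assms(2) unfolding stable_def by blast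
  ultimately show ?thesis using M(1) assms(1) unfolding mstable_def by blast
qed

lemma card_mstable_link:
  assumes "finite U" "S \<subseteq> U" "mstable (link U S) M"
  shows "card (M \<union> S) = card M + card S"
proof -
  have "M \<subseteq> U - S" using assms unfolding mstable_def link_def by blast
  then show ?thesis
    using assms by (intro card_Un_disjoint) (auto intro: finite_subset)
qed

lemma wc_link:
  assumes "finite U" "wc U" "S \<subseteq> U" "stable S"
  shows "wc (link U S)"
  unfolding wc_def
proof (intro allI impI)
  fix M M' assume "mstable (link U S) M" "mstable (link U S) M'"
  then have "mstable U (M \<union> S)" "mstable U (M' \<union> S)" "card (M \<union> S) = card M + card S"
    "card (M' \<union> S) = card M' + card S"
    using assms mstable_link card_mstable_link by simp_all
  moreover from this have "card (M \<union> S) = card (M' \<union> S)"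
    using wcD[OF assms(2)] by blast
  ultimately show "card M = card M'" by simp
qed

text \<open>Induction on \<open>S\<close>. For a maximal stable \<open>J\<close>, exchanging
  \<open>J \<inter> nbrs U S\<close> for \<open>S - J\<close> bounds \<open>card (S - J)\<close>,
  and the induction hypothesis bounds \<open>card (S \<inter> J)\<close>. The two bounds add up
  because \<open>J \<inter> nbrs U S\<close> and \<open>nbrs U (S \<inter> J)\<close> are disjoint
  parts of \<open>nbrs U S\<close>.\<close>

lemma card_le_card_nbrs:
  assumes "finite U" "wc U" "no_isolated U" "S \<subseteq> U" "stable S"
  shows "card S \<le> card (nbrs U S)"
proof -
  have "finite S" using assms finite_subset by blast
  then show ?thesis using assms(4,5)
  proof (induction S rule: finite_psubset_induct)
    case (psubset S)
    show ?case
    proof (cases "S = {}")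
      case False
      then obtain s v where s: "s \<in> S" "v \<in> U" "E s v"
        using assms(3) psubset.prems unfolding no_isolated_def nbrs_def by blast
      have "stable {v}" using irrefl unfolding stable_def by blast
      then obtain J where J: "v \<in> J" "mstable U J"
        using ex_mstable[of U "{v}"] assms(1) s by blast
      have JU: "J \<subseteq> U" "stable J" using J unfolding mstable_def by blast+
      have fin: "finite J" "finite (nbrs U S)" "finite S"
        using JU assms(1) psubset finite_subset unfolding nbrs_def by auto
      \<comment> \<open>The neighbour \<open>v\<close> of \<open>s\<close> was put into
        \<open>J\<close> to keep \<open>s\<close> out, so that \<open>S \<inter> J\<close> is a
        proper subset of \<open>S\<close>.\<close>
      have "s \<notin> J" using s J JU sym unfolding stable_def by blast
      then have "card (S \<inter> J) \<le> card (nbrs U (S \<inter> J))"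
        using psubset s stable_subset[of S "S \<inter> J"] by blast
      moreover have "card ((J - nbrs U S) \<union> S) \<le> card J"
      proof (intro card_stable_le[OF assms(1,2)])
        show "stable (J - nbrs U S \<union> S)"
          using JU psubset.prems sym unfolding stable_def nbrs_def by blast
      qed (use JU psubset J in auto)
      \<comment> \<open>The vertices of \<open>S \<inter> J\<close> already lie in
        \<open>J - nbrs U S\<close>, so only those of \<open>S - J\<close> are new.\<close>
      moreover have "card ((J - nbrs U S) \<union> S) = card (J - nbrs U S) + card (S - J)"
      proof -
        have "S \<inter> nbrs U S = {}" using psubset.prems unfolding stable_def nbrs_def by blast
        then have "(J - nbrs U S) \<union> S = (J - nbrs U S) \<union> (S - J)" by blast
        then show ?thesis using fin by (simp add: card_Un_disjoint Int_Diff disjoint_iff)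
      qed
      moreover have "card J = card (J - nbrs U S) + card (J \<inter> nbrs U S)"
        using fin(1) card_Int_Diff[of J "nbrs U S"] by simp
      moreover have "card S = card (S - J) + card (S \<inter> J)"
        using fin(3) card_Int_Diff[of S J] by simp
      moreover have "card (J \<inter> nbrs U S) + card (nbrs U (S \<inter> J)) \<le> card (nbrs U S)"
      proof -
        have "(J \<inter> nbrs U S) \<inter> nbrs U (S \<inter> J) = {}"
          using JU unfolding stable_def nbrs_def by blast
        moreover have sub: "(J \<inter> nbrs U S) \<union> nbrs U (S \<inter> J) \<subseteq> nbrs U S"
          unfolding nbrs_def by blast
        moreover have "finite (nbrs U (S \<inter> J))"
          using sub fin(2) finite_subset by blast
        ultimately show ?thesis
          using fin card_mono[OF fin(2) sub] by (simp add: card_Un_disjoint)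
      qed
      ultimately show ?thesis by linarith
    qed simp
  qed
qed

section \<open>Links of vertex decomposable graphs\<close>

lemma link_link:
  "link (link U S) T = link U (S \<union> T)" if "S \<subseteq> U" "T \<subseteq> link U S"
  using that unfolding link_def nbrs_def by blast

lemma vdec_link1:
  assumes "vdec U" "finite U" "v \<in> U"
  shows "vdec (link U {v})"
  using assms
proof (induction arbitrary: v rule: vdec.induct)
  case (edgeless U)
  have "link U {v} \<subseteq> U" unfolding link_def by blast
  then show ?case
    using edgeless wc_link[of U "{v}"] stable_subset irrefl
    by (intro vdec.edgeless) (auto simp: stable_def)
next
  case (shed U x)
  \<comment> \<open>If \<open>x\<close> is adjacent to \<open>v\<close>, the link of
    \<open>v\<close> has lost \<open>x\<close> anyway. If not, \<open>x\<close> remains a shedding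
    vertex of that link, since deleting \<open>x\<close> and taking its link both commute with the
    link of \<open>v\<close>.\<close>
  consider "v = x" | "v \<noteq> x" "E v x" | "v \<noteq> x" "\<not> E v x" by blast
  then show ?case
  proof cases
    case 1
    then show ?thesis using shed by simp
  next
    case 2
    then have "link U {v} = link (U - {x}) {v}"
      unfolding link_def nbrs_def by blast
    then show ?thesis using shed 2 by simp
  next
    case 3
    then have *: "\<not> E x v" using sym by blast
    show ?thesis
    proof (rule vdec.shed)
      show "wc (link U {v})" using shed wc_link[of U "{v}"] irrefl by (auto simp: stable_def)
      show "x \<in> link U {v}" using shed 3 unfolding link_def nbrs_def by blast
      have "link U {v} - {x} = link (U - {x}) {v}" unfolding link_def nbrs_def by blast
      then show "vdec (link U {v} - {x})" using shed 3 by simp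
      have "v \<in> link U {x}" "finite (link U {x})"
        using shed.prems 3 * unfolding link_def nbrs_def by auto
      moreover have "link (link U {v}) {x} = link (link U {x}) {v}"
        using 3 * unfolding link_def nbrs_def by blast
      ultimately show "vdec (link (link U {v}) {x})" using shed.IH(2) by simp
    qed
  qed
qed

lemma vdec_link:
  assumes "vdec U" "finite U" "S \<subseteq> U" "stable S"
  shows "vdec (link U S)"
proof -
  have "finite S" using assms finite_subset by blast
  then show ?thesis using assms(3,4)
  proof (induction S rule: finite_induct)
    case empty
    then show ?case using assms(1) by (simp add: link_def nbrs_def)
  next
    case (insert x S)
    have "x \<in> link U S" "S \<subseteq> U"
      using insert.prems insert.hyps unfolding link_def nbrs_def stable_def by blast+
    moreover have "vdec (link U S)"
      using insert stable_subset[of "insert x S" S] by blast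
    moreover have "finite (link U S)" using assms(2) unfolding link_def by blast
    ultimately have "vdec (link (link U S) {x})" using vdec_link1 by blast
    then show ?case using link_link[of S U "{x}"] \<open>x \<in> link U S\<close> \<open>S \<subseteq> U\<close> by simp
  qed
qed

section \<open>Balanced complete bipartite components, and leaves\<close>

lemma not_wc_complete_bipartite_minus_vertex:
  assumes "finite U" "A \<subseteq> U" "B \<subseteq> U"
    and A: "\<And>a. a \<in> A \<Longrightarrow> nbrs U {a} = B" and B: "\<And>b. b \<in> B \<Longrightarrow> nbrs U {b} = A"
    and "card A = card B" "2 \<le> card A" "x \<in> A"
  shows "\<not> wc (U - {x})"
proof
  assume wc: "wc (U - {x})"
  have fin: "finite A" "finite B" using assms finite_subset by blast+
  have AE: "E a u \<longleftrightarrow> u \<in> B" if "a \<in> A" "u \<in> U" for a u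
    using A[OF that(1)] that(2) unfolding nbrs_def by blast
  have BE: "E b u \<longleftrightarrow> u \<in> A" if "b \<in> B" "u \<in> U" for b u
    using B[OF that(1)] that(2) unfolding nbrs_def by blast
  have AB: "A \<inter> B = {}" using AE assms(2) irrefl by blast
  have cA: "card (A - {x}) = card A - 1" using assms(8) fin by simp
  then have "A - {x} \<noteq> {}" using assms(7) by (metis One_nat_def card.empty diff_is_0_eq not_less_eq_eq numeral_2_eq_2)
  then obtain a where a: "a \<in> A" "a \<noteq> x" by blast
  have "stable (A - {x})" using AE AB assms(2) unfolding stable_def by blast
  \<comment> \<open>As \<open>A - {x}\<close> is nonempty, \<open>M\<close> avoids \<open>B\<close>;
    exchanging \<open>A - {x}\<close> for \<open>B\<close> then gains exactly one vertex.\<close>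
  then obtain M where M: "A - {x} \<subseteq> M" "mstable (U - {x}) M"
    using ex_mstable[of "U - {x}" "A - {x}"] assms by blast
  have MU: "M \<subseteq> U" "x \<notin> M" "stable M" using M unfolding mstable_def by blast+
  have finM: "finite M" using MU assms(1) finite_subset by blast
  have MB: "M \<inter> B = {}" using MU M a AE unfolding stable_def by blast
  have "stable ((M - A) \<union> B)"
    using MU BE AB assms(3) sym unfolding stable_def by blast
  then have "card ((M - A) \<union> B) \<le> card M"
    by (intro card_stable_le[OF _ wc _ _ M(2)]) (use assms(1,3,8) MU AB in auto)
  moreover have "card ((M - A) \<union> B) = card (M - A) + card B"
    using fin finM MB by (intro card_Un_disjoint) auto
  moreover have "card M = card (M - A) + card (A - {x})"
  proof -
    have "M \<inter> A = A - {x}" using M MU by blast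
    then show ?thesis using card_Int_Diff[OF finM, of A] by simp
  qed
  ultimately show False using cA assms by linarith
qed

text \<open>A shedding vertex in the component would leave a set that is not well-covered; one
  outside leaves the component intact in \<open>U - {x}\<close>, where induction applies.\<close>

lemma vdec_no_complete_bipartite_component:
  assumes "vdec U" "finite U" "A \<subseteq> U" "B \<subseteq> U"
    and "\<And>a. a \<in> A \<Longrightarrow> nbrs U {a} = B" and "\<And>b. b \<in> B \<Longrightarrow> nbrs U {b} = A"
    and "card A = card B" "2 \<le> card A"
  shows False
  using assms
proof (induction rule: vdec.induct)
  case (edgeless U)
  then have "A \<noteq> {}" "B \<noteq> {}" by auto
  then show ?case using edgeless unfolding stable_def nbrs_def by blast
next
  case (shed U x)
  note fin = \<open>finite U\<close> and sub = \<open>A \<subseteq> U\<close> \<open>B \<subseteq> U\<close> and N = shed.prems(4,5) and card = shed.prems(6,7)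
  have wc: "wc (U - {x})" using shed.hyps vdec_wc by blast
  consider "x \<in> A" | "x \<in> B" | "x \<notin> A" "x \<notin> B" by blast
  then show ?case
  proof cases
    case 1
    have "\<not> wc (U - {x})"
      by (rule not_wc_complete_bipartite_minus_vertex[of U A B]) (use fin sub N card 1 in auto)
    then show ?thesis using wc by blast
  next
    case 2
    have "\<not> wc (U - {x})"
      by (rule not_wc_complete_bipartite_minus_vertex[of U B A]) (use fin sub N card 2 in auto)
    then show ?thesis using wc by blast
  next
    case 3
    have "nbrs (U - {x}) S = nbrs U S - {x}" for S unfolding nbrs_def by blast
    then show ?thesis
      using shed.IH(1)[OF _ _ _ _ _ card] fin sub N 3 by simp blast
  qed
qed

text \<open>The leaf \<open>x\<close> is isolated in \<open>U - {y}\<close> and sheds there: its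
  deletion and its link are both \<open>link U {x}\<close>.\<close>

lemma vdec_minus_leaf_neighbour:
  assumes "vdec U" "finite U" "x \<in> U" "nbrs U {x} = {y}"
  shows "vdec (U - {y})"
proof -
  have xy: "x \<noteq> y" "y \<in> U" "\<And>u. u \<in> U \<Longrightarrow> E x u \<longleftrightarrow> u = y"
    using assms(4) irrefl unfolding nbrs_def by auto
  have vl: "vdec (link U {x})" using vdec_link1 assms by blast
  have l: "link U {x} = U - {y} - {x}" using assms(4) unfolding link_def by blast
  have l': "link (U - {y}) {x} = U - {y} - {x}"
    using xy unfolding link_def nbrs_def by blast
  \<comment> \<open>Being isolated, \<open>x\<close> lies in every maximal stable set of
    \<open>U - {y}\<close>, so all sizes shift by one.\<close>
  have "mstable (U - {y} - {x}) (M - {x}) \<and> x \<in> M \<and> finite M" if M: "mstable (U - {y}) M" for M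
  proof -
    have "x \<in> M" using M xy assms(3) sym unfolding mstable_def by blast
    moreover have "mstable (U - {y} - {x}) (M - {x})"
      using M xy unfolding mstable_def stable_def by blast
    ultimately show ?thesis
      using M assms(2) finite_subset unfolding mstable_def by (metis Diff_subset finite_Diff)
  qed
  then have "wc (U - {y})"
    using vdec_wc[OF vl] l unfolding wc_def by (metis card.remove)
  then show ?thesis
    using vl l l' assms(3) xy by (intro vdec.shed[of "U - {y}" x]) auto
qed

end

section \<open>Very well-covered graphs without isolated vertices\<close>

locale very_well_covered_adjacency = adjacency +
  fixes V :: "'a set"
  assumes finV: "finite V"
    and wcV: "wc V"
    and isoV: "no_isolated V"
    and half: "mstable V S \<Longrightarrow> 2 * card S = card V"
begin

abbreviation N :: "'a \<Rightarrow> 'a set" where "N v \<equiv> nbrs V {v}"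

text \<open>In terms of a perfect matching, \<open>dom_by v\<close> is the set of partners of the vertices in \<open>N v\<close>.\<close>

definition dom_by :: "'a \<Rightarrow> 'a set" where
  "dom_by v = {t \<in> V. N t \<subseteq> N v \<and> t \<notin> N v}"

lemma N_iff: "u \<in> N v \<longleftrightarrow> u \<in> V \<and> E v u"
  unfolding nbrs_def by blast

lemma self_dom_by: "v \<in> V \<Longrightarrow> v \<in> dom_by v"
  using irrefl by (auto simp: dom_by_def N_iff)

lemma stable_dom_by: "stable (dom_by v)"
  unfolding stable_def dom_by_def N_iff nbrs_def by blast

text \<open>If \<open>s\<close> were a neighbour of \<open>v\<close>, then \<open>v\<close> would
  lie in \<open>N s\<close> and so in \<open>N t\<close>, making \<open>t\<close> a neighbour of
  \<open>v\<close>.\<close>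

lemma dom_by_trans: "v \<in> V \<Longrightarrow> t \<in> dom_by v \<Longrightarrow> s \<in> dom_by t \<Longrightarrow> s \<in> dom_by v"
  using sym unfolding dom_by_def nbrs_def by blast

lemma nbrs_dom_by: "v \<in> V \<Longrightarrow> nbrs V (dom_by v) = N v"
  using self_dom_by[of v] unfolding dom_by_def nbrs_def by blast

text \<open>For the lower bound, let \<open>W\<close> be the link of \<open>dom_by v\<close>. A
  vertex isolated in \<open>W\<close> would have all its neighbours in \<open>N v\<close> and so
  belong to \<open>dom_by v\<close>. Hence a maximal stable \<open>M\<close> of \<open>W\<close>
  fills at most half of \<open>W\<close>, whereas \<open>M\<close> together with
  \<open>dom_by v\<close> is exactly half of \<open>V\<close>.\<close>

lemma card_dom_by:
  assumes "v \<in> V"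
  shows "card (dom_by v) = card (N v)"
proof (rule antisym)
  let ?T = "dom_by v" and ?W = "link V (dom_by v)"
  have T: "?T \<subseteq> V" unfolding dom_by_def by blast
  show "card ?T \<le> card (N v)"
    using card_le_card_nbrs[OF finV wcV isoV T stable_dom_by] nbrs_dom_by assms by simp
  have W: "?W = V - (N v \<union> ?T)" unfolding link_def nbrs_dom_by[OF assms] ..
  have finW: "finite ?W" using finV unfolding link_def by blast
  have "no_isolated ?W"
    unfolding no_isolated_def
  proof
    fix r assume r: "r \<in> ?W"
    show "nbrs ?W {r} \<noteq> {}"
    proof
      assume e: "nbrs ?W {r} = {}"
      have "\<not> E r t" if "t \<in> ?T" for t
        using that r sym unfolding link_def nbrs_def by blast
      then have "N r \<subseteq> N v" using e W unfolding nbrs_def by blast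
      then have "r \<in> ?T" using r W unfolding dom_by_def by blast
      then show False using r W by blast
    qed
  qed
  moreover have "wc ?W" using wc_link[OF finV wcV T stable_dom_by] .
  moreover obtain M where M: "mstable ?W M"
    using ex_mstable[OF finW, of "{}"] by (auto simp: stable_def)
  then have MW: "M \<subseteq> ?W" "stable M" unfolding mstable_def by blast+
  ultimately have "card M \<le> card (nbrs ?W M)"
    using card_le_card_nbrs finW by blast
  also have "nbrs ?W M \<subseteq> ?W - M" using MW unfolding nbrs_def stable_def by blast
  then have "card (nbrs ?W M) \<le> card ?W - card M"
    using card_mono[of "?W - M" "nbrs ?W M"] finW MW card_Diff_subset[of M ?W] finite_subset
    by fastforce
  finally have "2 * card M \<le> card ?W"
    using card_mono[OF finW MW(1)] by linarith
  moreover have "card V = card ?W + (card (N v) + card ?T)"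
  proof -
    have sub: "N v \<union> ?T \<subseteq> V" using T unfolding nbrs_def by blast
    have fin: "finite (N v)" "finite ?T" using sub finV finite_subset by blast+
    have "N v \<inter> ?T = {}" unfolding dom_by_def by blast
    then have "card (N v \<union> ?T) = card (N v) + card ?T" using fin card_Un_disjoint by blast
    then show ?thesis
      using W sub finV card_Diff_subset[of "N v \<union> ?T" V] card_mono[OF finV sub] fin by simp
  qed
  moreover have "2 * (card M + card ?T) = card V"
    using half[OF mstable_link[OF T stable_dom_by M]] card_mstable_link[OF finV T M] by simp
  ultimately show "card (N v) \<le> card ?T" unfolding add_mult_distrib2 by linarith
qed

text \<open>Every maximal stable set through \<open>b'\<close> contains all of \<open>B\<close>. A
  neighbour \<open>c\<close> of \<open>b\<close> not adjacent to \<open>b'\<close> would lie with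
  \<open>b'\<close> in such a set, next to \<open>b\<close>.\<close>

lemma twins_opposite:
  assumes "A \<subseteq> V" "B \<subseteq> V" and A: "\<And>a. a \<in> A \<Longrightarrow> N a = B"
    and "card A = card B" "A \<noteq> {}" "b \<in> B" "b' \<in> B"
  shows "N b \<subseteq> N b'" "stable B"
proof -
  have fin: "finite B" using assms finV finite_subset by blast
  have AE: "E a u \<longleftrightarrow> u \<in> B" if "a \<in> A" "u \<in> V" for a u
    using A[OF that(1)] that(2) unfolding nbrs_def by blast
  have AB: "A \<inter> B = {}" using AE assms(1) irrefl by blast
  \<comment> \<open>exchanging \<open>M \<inter> B\<close> for \<open>A\<close> keeps \<open>M\<close> stable and cannot enlarge it\<close>
  have *: "B \<subseteq> M" if M: "mstable V M" "b' \<in> M" for M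
  proof -
    have MV: "M \<subseteq> V" "stable M" using M unfolding mstable_def by blast+
    have finM: "finite M" using MV finV finite_subset by blast
    have MA: "M \<inter> A = {}" using MV M AE assms(7) sym unfolding stable_def by blast
    have "stable ((M - B) \<union> A)"
      using MV AE AB assms(1) sym unfolding stable_def by blast
    then have "card ((M - B) \<union> A) \<le> card M"
      by (intro card_stable_le[OF finV wcV _ _ M(1)]) (use assms(1) MV in auto)
    moreover have "card ((M - B) \<union> A) = card (M - B) + card A"
      using finM MA assms(1) finV finite_subset by (intro card_Un_disjoint) auto
    moreover have "card M = card (M - B) + card (M \<inter> B)"
      using card_Int_Diff[OF finM, of B] by simp
    ultimately have "card B \<le> card (M \<inter> B)" using assms by linarith
    then have "M \<inter> B = B" using fin by (intro card_subset_eq) (auto simp: le_antisym card_mono)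
    then show ?thesis by blast
  qed
  have "stable {b'}" using irrefl unfolding stable_def by blast
  then obtain M where M: "b' \<in> M" "mstable V M"
    using ex_mstable[OF finV, of "{b'}"] assms(2,7) by blast
  then have "stable M" unfolding mstable_def by blast
  then show "stable B" using stable_subset *[OF M(2,1)] by blast
  show "N b \<subseteq> N b'"
  proof
    fix c assume c: "c \<in> N b"
    show "c \<in> N b'"
    proof (rule ccontr)
      assume "c \<notin> N b'"
      then have "stable {b', c}" using c irrefl sym unfolding stable_def N_iff by blast
      then obtain M where M: "b' \<in> M" "c \<in> M" "mstable V M"
        using ex_mstable[OF finV, of "{b', c}"] assms(2,7) c N_iff by blast
      then have "b \<in> M" using *[OF M(3,1)] assms(6) by blast
      then show False using M c unfolding N_iff mstable_def stable_def by blast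
    qed
  qed
qed

lemma vdec_no_twins:
  assumes "vdec V" "A \<subseteq> V" "B \<subseteq> V" and A: "\<And>a. a \<in> A \<Longrightarrow> N a = B"
    and card: "card A = card B" "2 \<le> card A"
  shows False
proof -
  have ne: "A \<noteq> {}" "B \<noteq> {}" using card by auto
  then obtain b where b: "b \<in> B" by blast
  have fin: "finite A" "finite B" using assms finV finite_subset by blast+
  have NB: "N b' = N b" if "b' \<in> B" for b'
    using twins_opposite(1)[OF assms(2,3) A card(1) ne(1) b that]
      twins_opposite(1)[OF assms(2,3) A card(1) ne(1) that b] by simp
  have stB: "stable B"
    using twins_opposite(2)[OF assms(2,3) A card(1) ne(1) b b] .
  have bV: "b \<in> V" using b assms by blast
  have AE: "E a u \<longleftrightarrow> u \<in> B" if "a \<in> A" "u \<in> V" for a u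
    using A[OF that(1)] that(2) unfolding nbrs_def by blast
  have AN: "A \<subseteq> N b" using AE[OF _ bV] b sym assms(2) by (auto simp: N_iff)
  have BT: "B \<subseteq> dom_by b"
  proof
    fix c assume c: "c \<in> B"
    then have "c \<notin> N b" using b stB unfolding N_iff stable_def by blast
    then show "c \<in> dom_by b" using NB[OF c] c assms(3) unfolding dom_by_def by auto
  qed
  \<comment> \<open>the link of \<open>?S\<close> isolates \<open>A \<union> B\<close>: it removes exactly the neighbours of \<open>B\<close> outside \<open>A\<close>\<close>
  let ?S = "dom_by b - B"
  have S: "?S \<subseteq> V" unfolding dom_by_def by blast
  have stS: "stable ?S" by (rule stable_subset[OF stable_dom_by]) blast
  have SN: "nbrs V ?S \<subseteq> N b - A"
  proof -
    have "nbrs V ?S \<subseteq> N b" using nbrs_dom_by[OF bV] unfolding nbrs_def by blast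
    moreover have "c \<notin> nbrs V ?S" if "c \<in> A" for c
      using AE[OF that] S sym unfolding nbrs_def by blast
    ultimately show ?thesis by blast
  qed
  have finN: "finite (N b)" using finV unfolding nbrs_def by auto
  \<comment> \<open>Counting turns the inclusion \<open>SN\<close> into an equality:
    \<open>N b\<close> and \<open>dom_by b\<close> have equal size, and so do the parts
    \<open>A\<close> and \<open>B\<close> taken away.\<close>
  have "card (N b - A) = card ?S"
    using card_dom_by[OF bV] card fin AN BT by (simp add: card_Diff_subset)
  also have "\<dots> \<le> card (nbrs V ?S)" using card_le_card_nbrs[OF finV wcV isoV S stS] .
  finally have SN': "nbrs V ?S = N b - A"
    using SN finN by (intro card_subset_eq) (auto simp: le_antisym card_mono)
  have L: "link V ?S = V - ((N b - A) \<union> (dom_by b - B))" unfolding link_def SN' ..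
  have NL: "nbrs (link V ?S) {u} = N u \<inter> link V ?S" for u
    unfolding link_def nbrs_def by blast
  have "N b \<inter> dom_by b = {}" unfolding dom_by_def by blast
  then have BL: "B \<subseteq> link V ?S" and AL: "A \<subseteq> link V ?S"
    using assms(2,3) BT AN unfolding L by blast+
  show False
  proof (rule vdec_no_complete_bipartite_component[OF vdec_link[OF assms(1) finV S stS] _ AL BL _ _ card])
    show "finite (link V ?S)" using finV unfolding link_def by blast
    show "nbrs (link V ?S) {a} = B" if "a \<in> A" for a
      unfolding NL using A[OF that] BL by blast
    show "nbrs (link V ?S) {b'} = A" if "b' \<in> B" for b'
      unfolding NL NB[OF that] using AL AN L by blast
  qed
qed

lemma ex_leaf_neighbour:
  assumes "vdec V" "v \<in> V"
  shows "\<exists>u t. u \<in> N v \<and> t \<in> V \<and> N t = {u}"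
proof -
  obtain t where t: "t \<in> dom_by v" and min: "\<And>s. s \<in> dom_by v \<Longrightarrow> card (N t) \<le> card (N s)"
    using ex_has_least_nat[of "\<lambda>t. t \<in> dom_by v" v "\<lambda>t. card (N t)"] self_dom_by[OF assms(2)] by blast
  have tV: "t \<in> V" "N t \<subseteq> N v" using t unfolding dom_by_def by blast+
  \<comment> \<open>Minimality of \<open>t\<close> was imposed over \<open>dom_by v\<close>, to
    which \<open>s\<close> belongs by transitivity.\<close>
  have "N s = N t" if s: "s \<in> dom_by t" for s
  proof (rule card_seteq)
    show "finite (N t)" using finV unfolding nbrs_def by auto
    show "N s \<subseteq> N t" using s unfolding dom_by_def by blast
    show "card (N t) \<le> card (N s)" using min dom_by_trans[OF assms(2) t s] by blast
  qed
  then have "\<not> 2 \<le> card (dom_by t)"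
    using vdec_no_twins[OF assms(1), of "dom_by t" "N t"] card_dom_by[OF tV(1)]
    unfolding dom_by_def nbrs_def by blast
  moreover have "card (N t) \<noteq> 0"
    using isoV tV finV unfolding no_isolated_def nbrs_def by simp
  ultimately have "card (N t) = 1" using card_dom_by[OF tV(1)] by linarith
  then show ?thesis using tV by (metis card_1_singletonE insert_subset)
qed

end

section \<open>Transfer between digraphs and vertex sets\<close>

lemma (in graph) adjacency_dominates: "adjacency (\<lambda>u v. u \<rightarrow>\<^bsub>G\<^esub> v)"
proof
  show "v \<rightarrow>\<^bsub>G\<^esub> u" if "u \<rightarrow>\<^bsub>G\<^esub> v" for u v
    using arcs_ends_symmetric[OF sym_arcs that] .
  show "\<not> u \<rightarrow>\<^bsub>G\<^esub> u" for u using adj_not_same by blast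
qed

context adjacency
begin

text \<open>\<open>E\<close> may relate vertices outside \<open>H\<close>, so one \<open>E\<close> serves all induced subgraphs of a graph.\<close>

definition realises :: "('a, 'b) pre_digraph \<Rightarrow> bool" where
  "realises H \<longleftrightarrow> wf_digraph H \<and> (\<forall>u \<in> verts H. \<forall>v \<in> verts H. u \<rightarrow>\<^bsub>H\<^esub> v \<longleftrightarrow> E u v)"

lemma neighbours_eq: "realises H \<Longrightarrow> x \<in> verts H \<Longrightarrow> neighbours H x = nbrs (verts H) {x}"
  unfolding realises_def neighbours_def nbrs_def by blast

lemma independent_set_iff: "realises H \<Longrightarrow> independent_set H S \<longleftrightarrow> S \<subseteq> verts H \<and> stable S"
  unfolding realises_def independent_set_def stable_def by blast

lemma maximal_independent_set_iff:
  assumes "realises H"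
  shows "maximal_independent_set H S \<longleftrightarrow> mstable (verts H) S"
proof
  assume *: "maximal_independent_set H S"
  then have S: "S \<subseteq> verts H" "stable S"
    unfolding maximal_independent_set_def independent_set_iff[OF assms] by blast+
  moreover have "\<exists>x \<in> S. E x y" if y: "y \<in> verts H - S" for y
  proof (rule ccontr)
    assume "\<not> (\<exists>x \<in> S. E x y)"
    then have "stable (insert y S)" using S sym irrefl unfolding stable_def by blast
    then have "independent_set H (insert y S)"
      using y S independent_set_iff[OF assms] by blast
    then show False using * y unfolding maximal_independent_set_def by blast
  qed
  ultimately show "mstable (verts H) S" unfolding mstable_def by blast
next
  assume "mstable (verts H) S"
  then show "maximal_independent_set H S"
    unfolding maximal_independent_set_def independent_set_iff[OF assms] mstable_def stable_def
    by blast
qed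

lemma well_covered_iff: "realises H \<Longrightarrow> well_covered H \<longleftrightarrow> wc (verts H)"
  by (simp add: well_covered_def wc_def maximal_independent_set_iff)

lemma arcs_empty_iff:
  assumes "realises H"
  shows "arcs H = {} \<longleftrightarrow> stable (verts H)"
proof -
  interpret wf_digraph H using assms unfolding realises_def by blast
  have "arcs H = {} \<longleftrightarrow> (\<forall>u \<in> verts H. \<forall>v \<in> verts H. \<not> u \<rightarrow>\<^bsub>H\<^esub> v)"
    by (force simp: arcs_ends_def arc_to_ends_def)
  then show ?thesis using assms unfolding realises_def stable_def by blast
qed

lemma realises_del_vert:
  assumes "realises H"
  shows "realises (pre_digraph.del_vert H x)"
proof -
  interpret wf_digraph H using assms unfolding realises_def by blast
  have "u \<rightarrow>\<^bsub>pre_digraph.del_vert H x\<^esub> v \<longleftrightarrow> u \<rightarrow>\<^bsub>H\<^esub> v" if "u \<noteq> x" "v \<noteq> x" for u v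
    using that by (auto simp: arcs_ends_def arc_to_ends_def del_vert_simps)
  then show ?thesis
    using assms wf_digraph_del_vert by (auto simp: realises_def verts_del_vert)
qed

lemma verts_del_verts: "verts (del_verts H S) = verts H - S"
  by (simp add: del_verts_def)

lemma realises_del_verts:
  assumes "realises H"
  shows "realises (del_verts H S)"
proof -
  interpret wf_digraph H using assms unfolding realises_def by blast
  have "u \<rightarrow>\<^bsub>del_verts H S\<^esub> v \<longleftrightarrow> u \<rightarrow>\<^bsub>H\<^esub> v" if "u \<in> verts H - S" "v \<in> verts H - S" for u v
    using that by (auto simp: arcs_ends_def arc_to_ends_def del_verts_def induce_subgraph_def)
  moreover have "wf_digraph (del_verts H S)"
    unfolding del_verts_def by (rule wellformed_induce_subgraph)
  ultimately show ?thesis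
    using assms by (simp add: realises_def verts_del_verts)
qed

lemma verts_del_closed_neighbours:
  "realises H \<Longrightarrow> x \<in> verts H \<Longrightarrow>
    verts (del_verts H (closed_neighbours H x)) = link (verts H) {x}"
  by (simp add: verts_del_verts closed_neighbours_def link_def neighbours_eq)

lemma vertex_decomposable_imp_vdec:
  assumes "vertex_decomposable H" "realises H"
  shows "vdec (verts H)"
  using assms
proof (induction rule: vertex_decomposable.induct)
  case (no_edges H)
  then show ?case using vdec.edgeless well_covered_iff arcs_empty_iff by blast
next
  case (shedding H x)
  then show ?case
    using vdec.shed[of "verts H" x] realises_del_vert[of H x]
      realises_del_verts[of H "closed_neighbours H x"] verts_del_closed_neighbours[of H x] well_covered_iff[of H]
    by (simp add: pre_digraph.verts_del_vert)
qed

text \<open>Carries shedding, established for vertex sets, back to the digraphs in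
  \<open>Shed\<close>. The induction varies \<open>H\<close>, since deletion and link are realised
  by different digraphs.\<close>

lemma vdec_imp_vertex_decomposable:
  assumes "vdec U" "realises H" "verts H = U"
  shows "vertex_decomposable H"
  using assms
proof (induction arbitrary: H rule: vdec.induct)
  case (edgeless U)
  then show ?case
    using vertex_decomposable.no_edges well_covered_iff[of H] arcs_empty_iff[of H] by simp
next
  case (shed U x)
  then show ?case
    using realises_del_vert[of H x] realises_del_verts[of H "closed_neighbours H x"]
      verts_del_closed_neighbours[of H x] well_covered_iff[of H]
    by (intro vertex_decomposable.shedding[of H x]) (simp_all add: pre_digraph.verts_del_vert)
qed

end

theorem theorem4p2:
  fixes G :: "('a, 'b) pre_digraph"
  assumes "graph G"
    and "no_isolated_vertices G"
    and "very_well_covered G"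
    and "vertex_decomposable G"
  shows "dominating_set G (Shed G)"
proof -
  interpret graph G by fact
  interpret adjacency "\<lambda>u v. u \<rightarrow>\<^bsub>G\<^esub> v" by (rule adjacency_dominates)
  have R: "realises G" unfolding realises_def using wf_digraph_axioms by blast
  interpret very_well_covered_adjacency "\<lambda>u v. u \<rightarrow>\<^bsub>G\<^esub> v" "verts G"
    using assms(2,3) R
    by unfold_locales
      (auto simp: very_well_covered_def no_isolated_vertices_def no_isolated_def well_covered_iff
        neighbours_eq maximal_independent_set_iff)
  have vd: "vdec (verts G)" using vertex_decomposable_imp_vdec[OF assms(4) R] .
  \<comment> \<open>The witness \<open>u\<close> is a neighbour of \<open>v\<close> whose deletion
    is handled through a leaf \<open>t\<close> attached to it; its link is vertex decomposable like
    every link.\<close>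
  have "\<exists>u \<in> Shed G. v \<rightarrow>\<^bsub>G\<^esub> u" if v: "v \<in> verts G" for v
  proof -
    obtain u t where u: "u \<in> N v" and t: "t \<in> verts G" "N t = {u}"
      using ex_leaf_neighbour[OF vd v] by blast
    have uV: "u \<in> verts G" using u N_iff by blast
    have "vertex_decomposable (pre_digraph.del_vert G u)"
      using vdec_minus_leaf_neighbour[OF vd finV t] realises_del_vert[OF R]
      by (rule vdec_imp_vertex_decomposable) (rule pre_digraph.verts_del_vert)
    moreover have "vertex_decomposable (del_verts G (closed_neighbours G u))"
      using vdec_link1[OF vd finV uV] realises_del_verts[OF R]
      by (rule vdec_imp_vertex_decomposable) (rule verts_del_closed_neighbours[OF R uV])
    ultimately show ?thesis using uV u N_iff unfolding Shed_def by blast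
  qed
  then show ?thesis unfolding dominating_set_def Shed_def by blast
qed

end
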